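(* Let $\mathcal{U},\mathcal{V}$ be infinite dimensional, separable, reflexive Banach spaces over $\mathbb{K}=\mathbb{R}$ or $\mathbb{C}$, let $a:\mathcal{U}\times\mathcal{V}\to\mathbb{K}$ be a continuous sesquilinear form, and let $(\mathcal{U}_n)_{n\in\mathbb{N}^*}$, $(\mathcal{V}_n)_{n\in\mathbb{N}^*}$ be approximating sequences of $\mathcal{U}$ and $\mathcal{V}$ respectively, with $0\neq\dim\mathcal{U}_n=\dim\mathcal{V}_n$ for all $n\in\mathbb{N}^*$. Then the following assertions are equivalent: (i) the Galerkin approximation (for $a$) converges; (ii) (BNB): there exists $\beta>0$ such that $\sup_{v\in\mathcal{V}_n,\|v\|_{\mathcal{V}}=1}|a(u,v)|\ge\beta\|u\|_{\mathcal{U}}$ for all $n\in\mathbb{N}^*$ and all $u\in\mathcal{U}_n$; (iii) (BNB$^*$): there exists $\beta^*>0$ such that $\sup_{u\in\mathcal{U}_n,\|u\|_{\mathcal{U}}=1}|a(u,v)|\ge\beta^*\|v\|_{\mathcal{V}}$ for all $n\in\mathbb{N}^*$ and all $v\in\mathcal{V}_n$; (iv) the dual Galerkin approximation converges.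
   Context: $\mathbb{N}^*=\{1,2,\dots\}$. A sesquilinear form is linear in the first and antilinear in the second variable (bilinear if $\mathbb{K}=\mathbb{R}$); $\mathcal{V}'$ denotes the space of continuous antilinear functionals on $\mathcal{V}$ (the usual dual if $\mathbb{K}=\mathbb{R}$), and $\langle L,v\rangle$ is the value of $L\in\mathcal{V}'$ at $v$. Continuity of $a$ means there is $M>0$ with $|a(u,v)|\le M\|u\|_{\mathcal{U}}\|v\|_{\mathcal{V}}$ for all $u,v$. Approximating sequence: for a separable Banach space $\mathcal{X}$, a sequence $(\mathcal{X}_n)_{n\in\mathbb{N}^*}$ of finite dimensional subspaces (not assumed nested) such that $\mathrm{dist}(x,\mathcal{X}_n):=\inf\{\|x-\chi\|:\chi\in\mathcal{X}_n\}\to0$ as $n\to\infty$ for all $x\in\mathcal{X}$. For $L\in\mathcal{V}'$ consider the problem (P): find $u\in\mathcal{U}$ with $a(u,v)=\langle L,v\rangle$ for all $v\in\mathcal{V}$; and the problem (P$_n$): find $u_n\in\mathcal{U}_n$ with $a(u_n,\chi)=\langle L,\chi\rangle$ for all $\chi\in\mathcal{V}_n$. A problem is well-posed if for every $L\in\mathcal{V}'$ it has a unique solution. "The Galerkin approximation converges" means: (P) and, for every $n\in\mathbb{N}^*$, (P$_n$) are well-posed, and there is a constant $\gamma>0$ independent of $n$ and $L$ such that $\|u-u_n\|_{\mathcal{U}}\le\gamma\,\mathrm{dist}(u,\mathcal{U}_n)$ for all $n\in\mathbb{N}^*$ and $L\in\mathcal{V}'$, where $u$ and $u_n$ are the solutions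 of (P) and (P$_n$). "The dual Galerkin approximation converges" means the same property with $a$ replaced by the adjoint form $a^*:\mathcal{V}\times\mathcal{U}\to\mathbb{K}$, $a^*(v,u)=\overline{a(u,v)}$, and the roles of $(\mathcal{U},\mathcal{U}_n)$ and $(\mathcal{V},\mathcal{V}_n)$ exchanged. *)

theory Defs
  imports "HOL-Analysis.Analysis"
begin

text \<open>
  The scalar field \<open>\<K>\<close>, i.e. \<open>\<real>\<close> or \<open>\<complex>\<close>: a type \<open>'k\<close> that is identified by
  \<open>to_complex\<close> with one of the subfields \<open>\<real>\<close>, \<open>\<complex>\<close> of the complex numbers, absolute value
  included, together with the conjugation inherited from there.
\<close>

class real_or_complex = real_normed_field +
  fixes to_complex :: "'a \<Rightarrow> complex"
    and scalar_cnj :: "'a \<Rightarrow> 'a"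
  assumes to_complex_add: "to_complex (x + y) = to_complex x + to_complex y"
    and to_complex_mult: "to_complex (x * y) = to_complex x * to_complex y"
    and to_complex_scaleR: "to_complex (r *\<^sub>R x) = r *\<^sub>R to_complex x"
    and norm_to_complex: "norm (to_complex x) = norm x"
    and range_to_complex: "range to_complex = \<real> \<or> range to_complex = UNIV"
    and to_complex_cnj: "to_complex (scalar_cnj x) = cnj (to_complex x)"

instantiation real :: real_or_complex
begin
definition "to_complex (x::real) = complex_of_real x"
definition "scalar_cnj (x::real) = x"
instance
  by standard (auto simp: to_complex_real_def scalar_cnj_real_def Reals_def scaleR_conv_of_real)
end

instantiation complex :: real_or_complex
begin
definition "to_complex (x::complex) = x"
definition "scalar_cnj (x::complex) = cnj x"
instance
  by standard (auto simp: to_complex_complex_def scalar_cnj_complex_def)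
end

text \<open>
  A Banach space over \<open>'k\<close>. The class \<^class>\<open>banach\<close> supplies addition, the norm, completeness and
  the underlying real structure, which has to be the restriction of the scalar multiplication
  \<open>scale\<close> to real scalars.
\<close>

locale banach_space_over = vector_space scale
  for scale :: "'k::real_or_complex \<Rightarrow> 'u::banach \<Rightarrow> 'u" +
  assumes norm_scale: "norm (scale c x) = norm c * norm x"
    and scale_of_real: "scale (of_real r) x = r *\<^sub>R x"

definition finite_dim_subspace ::
    "('k::real_or_complex \<Rightarrow> 'u::banach \<Rightarrow> 'u) \<Rightarrow> 'u set \<Rightarrow> bool" where
  "finite_dim_subspace s X \<longleftrightarrow>
     module.subspace s X \<and> (\<exists>B. finite B \<and> module.span s B = X)"

text \<open>
  In the next two definitions \<^const>\<open>bounded_linear\<close> means additive, real-homogeneous and bounded;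
  the remaining condition extends the homogeneity to all scalars.
\<close>

definition dual_space :: "('k::real_or_complex \<Rightarrow> 'u::banach \<Rightarrow> 'u) \<Rightarrow> ('u \<Rightarrow> 'k) set" where
  "dual_space s = {f. bounded_linear f \<and> (\<forall>c x. f (s c x) = c * f x)}"

definition antidual_space :: "('k::real_or_complex \<Rightarrow> 'u::banach \<Rightarrow> 'u) \<Rightarrow> ('u \<Rightarrow> 'k) set" where
  "antidual_space s = {L. bounded_linear L \<and> (\<forall>c x. L (s c x) = scalar_cnj c * L x)}"

text \<open>
  A bidual element is a linear \<open>\<Phi>\<close> on the dual space that is bounded for the dual norm
  \<^const>\<open>onorm\<close>; its values outside the dual space are irrelevant.
\<close>

definition bidual_element ::
    "('k::real_or_complex \<Rightarrow> 'u::banach \<Rightarrow> 'u) \<Rightarrow> (('u \<Rightarrow> 'k) \<Rightarrow> 'k) \<Rightarrow> bool" where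
  "bidual_element s \<Phi> \<longleftrightarrow>
     (\<forall>f\<in>dual_space s. \<forall>g\<in>dual_space s. \<Phi> (\<lambda>x. f x + g x) = \<Phi> f + \<Phi> g) \<and>
     (\<forall>c. \<forall>f\<in>dual_space s. \<Phi> (\<lambda>x. c * f x) = c * \<Phi> f) \<and>
     (\<exists>C. \<forall>f\<in>dual_space s. norm (\<Phi> f) \<le> C * onorm f)"

definition reflexive_space :: "('k::real_or_complex \<Rightarrow> 'u::banach \<Rightarrow> 'u) \<Rightarrow> bool" where
  "reflexive_space s \<longleftrightarrow>
     (\<forall>\<Phi>. bidual_element s \<Phi> \<longrightarrow> (\<exists>x. \<forall>f\<in>dual_space s. \<Phi> f = f x))"

text \<open>
  Sequences indexed by \<open>1, 2, \<dots>\<close> are functions on \<^typ>\<open>nat\<close> whose value at \<open>0\<close> is ignored.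
  On a nonempty set \<^const>\<open>infdist\<close> is the infimum of the distances.
\<close>

definition approximating_sequence ::
    "('k::real_or_complex \<Rightarrow> 'u::banach \<Rightarrow> 'u) \<Rightarrow> (nat \<Rightarrow> 'u set) \<Rightarrow> bool" where
  "approximating_sequence s X \<longleftrightarrow>
     (\<forall>n\<ge>1. finite_dim_subspace s (X n)) \<and> (\<forall>x. (\<lambda>n. infdist x (X n)) \<longlonglongrightarrow> 0)"

definition sesquilinear ::
    "('k::real_or_complex \<Rightarrow> 'u::banach \<Rightarrow> 'u) \<Rightarrow> ('k \<Rightarrow> 'v::banach \<Rightarrow> 'v) \<Rightarrow>
     ('u \<Rightarrow> 'v \<Rightarrow> 'k) \<Rightarrow> bool" where
  "sesquilinear s t a \<longleftrightarrow>
     (\<forall>u u' v. a (u + u') v = a u v + a u' v) \<and>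
     (\<forall>c u v. a (s c u) v = c * a u v) \<and>
     (\<forall>u v v'. a u (v + v') = a u v + a u v') \<and>
     (\<forall>c u v. a u (t c v) = scalar_cnj c * a u v)"

definition continuous_form :: "('u::banach \<Rightarrow> 'v::banach \<Rightarrow> 'k::real_or_complex) \<Rightarrow> bool" where
  "continuous_form a \<longleftrightarrow> (\<exists>M>0. \<forall>u v. norm (a u v) \<le> M * norm u * norm v)"

definition adjoint_form :: "('u \<Rightarrow> 'v \<Rightarrow> 'k::real_or_complex) \<Rightarrow> 'v \<Rightarrow> 'u \<Rightarrow> 'k" where
  "adjoint_form a v u = scalar_cnj (a u v)"

text \<open>
  The problem with trial space \<open>X\<close> and test space \<open>Y\<close>; the full problem is the case
  \<open>X = UNIV\<close>, \<open>Y = UNIV\<close>. The data \<open>L\<close> always range over the antidual of the whole test space.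
\<close>

definition is_solution ::
    "('u \<Rightarrow> 'v \<Rightarrow> 'k) \<Rightarrow> 'u set \<Rightarrow> 'v set \<Rightarrow> ('v \<Rightarrow> 'k) \<Rightarrow> 'u \<Rightarrow> bool" where
  "is_solution a X Y L u \<longleftrightarrow> u \<in> X \<and> (\<forall>v\<in>Y. a u v = L v)"

definition well_posed ::
    "('k::real_or_complex \<Rightarrow> 'v::banach \<Rightarrow> 'v) \<Rightarrow> ('u \<Rightarrow> 'v \<Rightarrow> 'k) \<Rightarrow>
     'u set \<Rightarrow> 'v set \<Rightarrow> bool" where
  "well_posed t a X Y \<longleftrightarrow> (\<forall>L\<in>antidual_space t. \<exists>!u. is_solution a X Y L u)"

text \<open>Only the scalar multiplication \<open>t\<close> of the test space enters, through its antidual.\<close>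

definition galerkin_converges ::
    "('k::real_or_complex \<Rightarrow> 'v::banach \<Rightarrow> 'v) \<Rightarrow> ('u::banach \<Rightarrow> 'v \<Rightarrow> 'k) \<Rightarrow>
     (nat \<Rightarrow> 'u set) \<Rightarrow> (nat \<Rightarrow> 'v set) \<Rightarrow> bool" where
  "galerkin_converges t a U V \<longleftrightarrow>
     well_posed t a UNIV UNIV \<and>
     (\<forall>n\<ge>1. well_posed t a (U n) (V n)) \<and>
     (\<exists>\<gamma>>0. \<forall>n\<ge>1. \<forall>L\<in>antidual_space t. \<forall>u u\<^sub>n.
        is_solution a UNIV UNIV L u \<longrightarrow> is_solution a (U n) (V n) L u\<^sub>n \<longrightarrow>
        norm (u - u\<^sub>n) \<le> \<gamma> * infdist u (U n))"

text \<open>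
  The supremum is the real-valued \<open>Sup\<close>, meaningful for a bounded form on \<open>Y \<noteq> {0}\<close>, where the set
  of values is bounded and nonempty.
\<close>

definition BNB :: "('u::banach \<Rightarrow> 'v::banach \<Rightarrow> 'k::real_or_complex) \<Rightarrow>
     (nat \<Rightarrow> 'u set) \<Rightarrow> (nat \<Rightarrow> 'v set) \<Rightarrow> bool" where
  "BNB a U V \<longleftrightarrow>
     (\<exists>\<beta>>0. \<forall>n\<ge>1. \<forall>u\<in>U n. (SUP v\<in>{v\<in>V n. norm v = 1}. norm (a u v)) \<ge> \<beta> * norm u)"

definition BNB_star :: "('u::banach \<Rightarrow> 'v::banach \<Rightarrow> 'k::real_or_complex) \<Rightarrow>
     (nat \<Rightarrow> 'u set) \<Rightarrow> (nat \<Rightarrow> 'v set) \<Rightarrow> bool" where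
  "BNB_star a U V \<longleftrightarrow>
     (\<exists>\<beta>>0. \<forall>n\<ge>1. \<forall>v\<in>V n. (SUP u\<in>{u\<in>U n. norm u = 1}. norm (a u v)) \<ge> \<beta> * norm v)"

end

theory Submission
  imports Defs
begin

text \<open>
  Everything is phrased through the inf-sup inequality with constant \<open>\<beta>\<close> on \<open>X \<times> Y\<close>: the
  functional \<open>a u\<close> on \<open>Y\<close> has norm at least \<open>\<beta> * norm u\<close> for \<open>u \<in> X\<close>. (BNB) says that one
  \<open>\<beta> > 0\<close> serves all the pairs \<open>U n\<close>, \<open>V n\<close>, and (BNB*) is (BNB) for the adjoint form. Since the
  setting is invariant under passing to the adjoint form, three implications, each also applied to
  the adjoint form, give all the equivalences.

  (BNB) implies (BNB*), with the same constant. The inf-sup inequality makes the operator of the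
  discrete problem injective, hence bijective because the dimensions agree
  (\<open>finite_dim_well_posed\<close>). Given \<open>v \<in> V n\<close>, take a functional of norm one that attains
  \<open>norm v\<close> at \<open>v\<close>, by Hahn-Banach, and let \<open>u \<in> U n\<close> solve the discrete problem for it. Then
  \<open>\<beta> * norm u \<le> 1\<close> and \<open>a u v = norm v\<close>, so \<open>u\<close> witnesses the adjoint inequality at \<open>v\<close>
  (\<open>inf_sup_bound_adjoint\<close>).

  (BNB) implies convergence. By density both inf-sup inequalities pass to the whole spaces
  (\<open>inf_sup_bound_UNIV\<close>). The one for \<open>a\<close> gives uniqueness in the continuous problem. The adjoint
  one says that \<open>v \<mapsto> a(-, v)\<close> is bounded below as a map into the dual of the trial space, so
  \<open>a(-, v) \<mapsto> L v\<close> is a bounded functional on a subspace of that dual; a Hahn-Banach extension is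
  an element of the bidual, and by reflexivity it is evaluation at some \<open>u\<close>, which solves the
  problem (\<open>solution_exists_if_reflexive\<close>). The error estimate is the classical argument of Cea
  (\<open>quasi_optimality\<close>).

  Convergence implies (BNB*). Let \<open>T\<close> be the set of all \<open>v\<close>, in any \<open>V n\<close>, whose functional
  \<open>a(-, v)\<close> has norm at most one on \<open>U n\<close>. For each datum \<open>L\<close> the discrete solutions \<open>u\<^sub>n\<close> are
  bounded by \<open>(1 + \<gamma>) * norm u\<close>, where \<open>u\<close> is the solution for \<open>L\<close>, so
  \<open>L v = a u\<^sub>n v\<close> is bounded on \<open>T\<close>. Thus \<open>T\<close> is weakly bounded, hence bounded by the uniform boundedness principle, and a bound on its norms is the
  inverse of an inf-sup constant for the adjoint form
  (\<open>BNB_adjoint_if_galerkin_converges\<close>).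
\<close>

section \<open>Scalars and their real parts\<close>

lemma to_complex_0 [simp]: "to_complex (0::'k::real_or_complex) = 0"
  using norm_to_complex[of "0::'k"] by simp

lemma to_complex_1 [simp]: "to_complex (1::'k::real_or_complex) = 1"
proof -
  have "to_complex (1::'k) * to_complex (1::'k) = to_complex (1::'k)"
    by (metis mult_1 to_complex_mult)
  moreover have "to_complex (1::'k) \<noteq> 0"
    using norm_to_complex[of "1::'k"] by force
  ultimately show ?thesis by simp
qed

lemma to_complex_of_real [simp]: "to_complex (of_real r :: 'k::real_or_complex) = of_real r"
  using to_complex_scaleR[of r "1::'k"] by (simp add: of_real_def)

lemma to_complex_minus [simp]: "to_complex (- x :: 'k::real_or_complex) = - to_complex x"
  using to_complex_scaleR[of "-1" x] by simp

lemma to_complex_diff: "to_complex (x - y :: 'k::real_or_complex) = to_complex x - to_complex y"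
  using to_complex_add[of x "- y"] by simp

lemma to_complex_eq_iff [simp]: "to_complex x = to_complex y \<longleftrightarrow> x = (y :: 'k::real_or_complex)"
  using norm_to_complex[of "x - y"] by (auto simp: to_complex_diff)

lemma to_complex_eqI: "to_complex x = to_complex (y :: 'k::real_or_complex) \<Longrightarrow> x = y"
  by simp

lemma scalar_cnj_cnj [simp]: "scalar_cnj (scalar_cnj x) = (x :: 'k::real_or_complex)"
  by (rule to_complex_eqI) (simp add: to_complex_cnj)

lemma scalar_cnj_add: "scalar_cnj (x + y) = scalar_cnj x + scalar_cnj (y :: 'k::real_or_complex)"
  by (rule to_complex_eqI) (simp add: to_complex_cnj to_complex_add)

lemma scalar_cnj_mult: "scalar_cnj (x * y) = scalar_cnj x * scalar_cnj (y :: 'k::real_or_complex)"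
  by (rule to_complex_eqI) (simp add: to_complex_cnj to_complex_mult)

lemma scalar_cnj_of_real [simp]: "scalar_cnj (of_real r) = (of_real r :: 'k::real_or_complex)"
  by (rule to_complex_eqI) (simp add: to_complex_cnj)

lemma norm_scalar_cnj [simp]: "norm (scalar_cnj x) = norm (x :: 'k::real_or_complex)"
  by (metis complex_mod_cnj norm_to_complex to_complex_cnj)

definition real_part :: "'k::real_or_complex \<Rightarrow> real" where
  "real_part c = Re (to_complex c)"

lemma real_part_simps [simp]:
  "real_part (0::'k::real_or_complex) = 0"
  "real_part (of_real r :: 'k) = r"
  "real_part (x + y :: 'k) = real_part x + real_part y"
  "real_part (r *\<^sub>R x :: 'k) = r * real_part x"
  by (simp_all add: real_part_def to_complex_add to_complex_scaleR)

lemma real_part_le_norm: "\<bar>real_part (x :: 'k::real_or_complex)\<bar> \<le> norm x"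
  by (metis abs_Re_le_cmod norm_to_complex real_part_def)

lemma scalar_field_cases:
  obtains (real) "\<And>c :: 'k::real_or_complex. c = of_real (real_part c)"
  | (complex) j :: "'k::real_or_complex" where "j * j = - 1"
      "\<And>c :: 'k::real_or_complex. \<exists>x y. c = of_real x + of_real y * j"
proof (cases "range (to_complex :: 'k \<Rightarrow> complex) = \<real>")
  case True
  have "c = of_real (real_part c)" for c :: 'k
  proof -
    have "to_complex c \<in> \<real>"
      using True by blast
    then have "to_complex c = to_complex (of_real (real_part c) :: 'k)"
      by (auto simp: real_part_def Reals_def)
    then show ?thesis
      by (rule to_complex_eqI)
  qed
  then show ?thesis by (rule real)
next
  case False
  then have "\<i> \<in> range (to_complex :: 'k \<Rightarrow> complex)"
    using range_to_complex[where 'a = 'k] by simp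
  then obtain j :: 'k where j: "to_complex j = \<i>" by (metis rangeE)
  have "j * j = - 1"
    by (rule to_complex_eqI) (simp add: to_complex_mult j)
  moreover have "\<exists>x y. c = of_real x + of_real y * j" for c :: 'k
    by (rule exI[of _ "Re (to_complex c)"], rule exI[of _ "Im (to_complex c)"], rule to_complex_eqI)
      (simp add: to_complex_mult to_complex_add j complex_eq_iff)
  ultimately show ?thesis by (rule complex)
qed

section \<open>The Hahn-Banach theorem over the scalar field\<close>

text \<open>
  Functionals have to be extended from subspaces of Banach spaces and also from subspaces of a space
  of bounded linear maps into the scalars, whose type does not belong to the class
  \<^class>\<open>banach\<close>.
\<close>

locale normed_space_over = vector_space scale
  for scale :: "'k::real_or_complex \<Rightarrow> 'a::real_normed_vector \<Rightarrow> 'a" +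
  assumes norm_scale: "norm (scale c x) = norm c * norm x"
    and scale_of_real: "scale (of_real r) x = r *\<^sub>R x"

sublocale banach_space_over \<subseteq> normed_space_over
  by unfold_locales (simp_all add: norm_scale scale_of_real)

text \<open>
  A functional that is linear over the scalars can be recovered from its real part \<open>\<psi>\<close>: over the
  complex numbers it must be \<open>\<psi> x - \<i> \<psi> (\<i> x)\<close>. This reduces extension problems over both fields
  to real ones.
\<close>

lemma (in normed_space_over) scalar_functional_with_real_part:
  fixes \<psi> :: "'a \<Rightarrow> real"
  assumes add: "\<And>x y. \<psi> (x + y) = \<psi> x + \<psi> y" and scaleR: "\<And>r x. \<psi> (r *\<^sub>R x) = r * \<psi> x"
  obtains \<phi> :: "'a \<Rightarrow> 'k" where "\<And>x y. \<phi> (x + y) = \<phi> x + \<phi> y"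
    "\<And>c x. \<phi> (scale c x) = c * \<phi> x" "\<And>x. real_part (\<phi> x) = \<psi> x"
proof (cases rule: scalar_field_cases[where 'k = 'k])
  case real
  have "of_real (\<psi> (scale c x)) = c * of_real (\<psi> x)" for c :: 'k and x
    by (metis real scale_of_real scaleR of_real_mult)
  then show ?thesis
    by (intro that[of "\<lambda>x. of_real (\<psi> x)"]) (simp_all add: add)
next
  case (complex j)
  define \<phi> where "\<phi> x = of_real (\<psi> x) - j * of_real (\<psi> (scale j x))" for x
  have \<phi>_add: "\<phi> (x + y) = \<phi> x + \<phi> y" for x y
    by (simp add: \<phi>_def add scale_right_distrib algebra_simps)
  have scale_j: "scale j (scale j x) = (- 1) *\<^sub>R x" for x
    using complex(1) scale_of_real[of "- 1" x] by simp
  have \<phi>_j: "\<phi> (scale j x) = j * \<phi> x" for x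
    using complex(1) scaleR[of "- 1" x] unfolding \<phi>_def scale_j
    by (simp add: algebra_simps flip: mult.assoc)
  have \<phi>_real: "\<phi> (scale (of_real r) x) = of_real r * \<phi> x" for r x
  proof -
    have "scale j (scale (of_real r) x) = r *\<^sub>R scale j x"
      by (metis mult.commute scale_of_real scale_scale)
    then show ?thesis
      by (simp add: \<phi>_def scale_of_real scaleR algebra_simps)
  qed
  have \<phi>_scale: "\<phi> (scale c x) = c * \<phi> x" for c x
  proof -
    obtain p q where c: "c = of_real p + of_real q * j" using complex(2) by blast
    have "scale c x = scale (of_real p) x + scale (of_real q) (scale j x)"
      by (simp add: c scale_left_distrib)
    then show ?thesis
      by (simp add: \<phi>_add \<phi>_real \<phi>_j c distrib_right mult.assoc del: scale_scale)
  qed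
  have "to_complex j * to_complex j = - 1"
    by (metis complex(1) to_complex_1 to_complex_minus to_complex_mult)
  then have "Re (to_complex j) = 0"
    by (auto simp: complex_eq_iff) (smt (verit) zero_le_square mult_eq_0_iff)
  then have "real_part (\<phi> x) = \<psi> x" for x
    by (simp add: \<phi>_def real_part_def to_complex_diff to_complex_mult)
  with \<phi>_add \<phi>_scale show ?thesis by (rule that)
qed

text \<open>
  Multiplying \<open>x\<close> by a scalar of absolute value one makes \<open>\<phi> x\<close> equal to its own norm while
  \<open>norm x\<close> stays the same, so bounds on the real part are bounds on the norm.
\<close>

lemma (in normed_space_over) norm_le_if_real_part_le:
  fixes \<phi> :: "'a \<Rightarrow> 'k"
  assumes scale: "\<And>c x. \<phi> (scale c x) = c * \<phi> x" and le: "\<And>x. real_part (\<phi> x) \<le> C * norm x"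
  shows "norm (\<phi> x) \<le> C * norm x"
proof (cases "\<phi> x = 0")
  case True
  then show ?thesis using le[of x] by simp
next
  case False
  define c where "c = of_real (norm (\<phi> x)) / \<phi> x"
  have "norm c = 1" and "\<phi> (scale c x) = of_real (norm (\<phi> x))"
    using False by (simp_all add: c_def norm_divide scale)
  then show ?thesis
    using le[of "scale c x"] by (simp add: norm_scale)
qed

text \<open>
  The real Hahn-Banach theorem. Partial extensions are represented by their graphs, as subspaces
  \<open>G\<close> of \<open>'a \<times> \<real>\<close> that lie below \<open>p\<close>. Such a subspace is automatically the graph of a function:
  if it contains \<open>(0, r)\<close> it also contains \<open>(0, - r)\<close>, so \<open>r\<close> and \<open>- r\<close> are at most \<open>p 0 = 0\<close>.
  Zorn's lemma gives a maximal graph, and adjoining one more vector to it shows that it is total.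
\<close>

lemma linear_extension_dominated:
  fixes \<phi> :: "'a::real_vector \<Rightarrow> real" and p :: "'a \<Rightarrow> real"
  assumes p_add: "\<And>x y. p (x + y) \<le> p x + p y"
    and p_scale: "\<And>r x. r > 0 \<Longrightarrow> p (r *\<^sub>R x) = r * p x"
    and W: "subspace W"
    and \<phi>_add: "\<And>x y. x \<in> W \<Longrightarrow> y \<in> W \<Longrightarrow> \<phi> (x + y) = \<phi> x + \<phi> y"
    and \<phi>_scale: "\<And>r x. x \<in> W \<Longrightarrow> \<phi> (r *\<^sub>R x) = r * \<phi> x"
    and \<phi>_le: "\<And>x. x \<in> W \<Longrightarrow> \<phi> x \<le> p x"
  obtains \<psi> where "linear \<psi>" "\<And>x. x \<in> W \<Longrightarrow> \<psi> x = \<phi> x" "\<And>x. \<psi> x \<le> p x"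
proof -
  define G0 where "G0 = (\<lambda>x. (x, \<phi> x)) ` W"
  define \<G> where "\<G> = {G. subspace G \<and> G0 \<subseteq> G \<and> (\<forall>(x, r)\<in>G. r \<le> p x)}"
  have "subspace G0"
    unfolding G0_def
  proof (rule subspaceI)
    show "0 \<in> (\<lambda>x. (x, \<phi> x)) ` W"
      using W subspace_0[OF W] \<phi>_scale[of 0 0] by (auto simp: zero_prod_def image_iff)
  qed (use W \<phi>_add \<phi>_scale in \<open>auto simp: image_iff subspace_add subspace_scale\<close>)
  then have "G0 \<in> \<G>"
    using \<phi>_le by (auto simp: \<G>_def G0_def)
  have "\<Union>\<C> \<in> \<G>" if "\<C> \<noteq> {}" and chain: "subset.chain \<G> \<C>" for \<C>
  proof -
    have \<C>: "\<C> \<subseteq> \<G>" and tot: "\<And>A B. A \<in> \<C> \<Longrightarrow> B \<in> \<C> \<Longrightarrow> A \<subseteq> B \<or> B \<subseteq> A"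
      using chain by (auto simp: subset.chain_def)
    have "subspace (\<Union>\<C>)"
    proof (rule subspaceI)
      show "0 \<in> \<Union>\<C>"
        using \<C> \<open>\<C> \<noteq> {}\<close> unfolding \<G>_def by (blast intro: subspace_0)
    next
      fix x y assume "x \<in> \<Union>\<C>" "y \<in> \<Union>\<C>"
      then obtain A B where "A \<in> \<C>" "B \<in> \<C>" "x \<in> A" "y \<in> B" by blast
      then obtain D where "D \<in> \<C>" "x \<in> D" "y \<in> D" using tot by blast
      then show "x + y \<in> \<Union>\<C>" using \<C> by (auto simp: \<G>_def intro: subspace_add)
    next
      fix x r assume "x \<in> \<Union>\<C>"
      then show "r *\<^sub>R x \<in> \<Union>\<C>" using \<C> by (auto simp: \<G>_def intro: subspace_scale)
    qed
    then show ?thesis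
      using \<C> \<open>\<C> \<noteq> {}\<close> by (fastforce simp: \<G>_def)
  qed
  with \<open>G0 \<in> \<G>\<close> obtain G where G: "G \<in> \<G>" and max: "\<And>H. H \<in> \<G> \<Longrightarrow> G \<subseteq> H \<Longrightarrow> H = G"
    using subset_Zorn_nonempty[of \<G>] by blast
  have subG: "subspace G" and "G0 \<subseteq> G" and G_le: "\<And>x r. (x, r) \<in> G \<Longrightarrow> r \<le> p x"
    using G by (auto simp: \<G>_def)
  have G_add: "(x + y, r + s) \<in> G" if "(x, r) \<in> G" "(y, s) \<in> G" for x y r s
    using subspace_add[OF subG that] by simp
  have G_scale: "(t *\<^sub>R x, t * r) \<in> G" if "(x, r) \<in> G" for x r t
    using subspace_scale[OF subG that, of t] by simp
  have "p 0 = 0"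
    using p_scale[of 2 0] by simp
  have unique: "r = s" if "(x, r) \<in> G" "(x, s) \<in> G" for x r s
    using G_le[of 0 "r - s"] G_le[of 0 "s - r"] \<open>p 0 = 0\<close>
      subspace_diff[OF subG that] subspace_diff[OF subG that(2,1)] by simp
  have total: "\<exists>r. (x, r) \<in> G" for x
  proof -
    (* The value alpha at x has to lie above every r - p (y - x) and below every p (z + x) - s, for
       points (y, r) and (z, s) of the graph; sublinearity leaves room for such a number. *)
    define A where "A = {r - p (y - x) | y r. (y, r) \<in> G}"
    define \<alpha> where "\<alpha> = Sup A"
    have below: "r - p (y - x) \<le> p (z + x) - s" if "(y, r) \<in> G" "(z, s) \<in> G" for y z r s
      using G_le[OF G_add[OF that]] p_add[of "y - x" "z + x"] by simp
    have "(0, 0) \<in> G"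
      using subspace_0[OF subG] by (simp add: zero_prod_def)
    have "A \<noteq> {}"
      using \<open>(0, 0) \<in> G\<close> by (auto simp: A_def)
    moreover have "bdd_above A"
      using below[OF _ \<open>(0, 0) \<in> G\<close>] by (auto simp: A_def intro!: bdd_aboveI)
    ultimately have lower: "r - p (y - x) \<le> \<alpha>" and upper: "\<alpha> \<le> p (y + x) - r"
      if "(y, r) \<in> G" for y r
      using that below by (auto simp: \<alpha>_def A_def intro!: cSup_upper cSup_least)
    have le: "r + t * \<alpha> \<le> p (y + t *\<^sub>R x)" if "(y, r) \<in> G" for y r t
    proof (cases t "0::real" rule: linorder_cases)
      case less
      have "(1 / - t) * r - p ((1 / - t) *\<^sub>R y - x) \<le> \<alpha>"
        using lower[OF G_scale[OF that]] by blast
      moreover have "(1 / - t) *\<^sub>R y - x = (1 / - t) *\<^sub>R (y + t *\<^sub>R x)"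
        using less by (simp add: scaleR_add_right)
      then have "p ((1 / - t) *\<^sub>R y - x) = (1 / - t) * p (y + t *\<^sub>R x)"
        using less p_scale[of "1 / - t" "y + t *\<^sub>R x"] by (metis neg_0_less_iff_less zero_less_divide_1_iff)
      ultimately show ?thesis
        using less by (simp add: field_simps)
    next
      case equal
      then show ?thesis using G_le[OF that] by simp
    next
      case greater
      have "\<alpha> \<le> p ((1 / t) *\<^sub>R y + x) - (1 / t) * r"
        using upper[OF G_scale[OF that]] by blast
      moreover have "p ((1 / t) *\<^sub>R y + x) = (1 / t) * p (y + t *\<^sub>R x)"
        using greater p_scale[of "1 / t" "y + t *\<^sub>R x"] by (simp add: algebra_simps)
      ultimately show ?thesis
        using greater by (simp add: field_simps)
    qed
    define H where "H = {g + h | g h. g \<in> G \<and> h \<in> span {(x, \<alpha>)}}"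
    have "subspace H"
      unfolding H_def by (rule subspace_sums[OF subG subspace_span])
    have "G \<subseteq> H"
    proof
      fix g assume "g \<in> G"
      then show "g \<in> H"
        unfolding H_def using span_zero by (metis (mono_tags, lifting) CollectI add.right_neutral)
    qed
    have "s \<le> p z" if "(z, s) \<in> H" for z s
      using that le by (auto simp: H_def span_singleton)
    then have "H \<in> \<G>"
      using \<open>G \<subseteq> H\<close> \<open>G0 \<subseteq> G\<close> \<open>subspace H\<close> by (auto simp: \<G>_def)
    then have "H = G"
      using max \<open>G \<subseteq> H\<close> by blast
    moreover have "(x, \<alpha>) \<in> H"
      unfolding H_def using subspace_0[OF subG] span_base[of "(x, \<alpha>)" "{(x, \<alpha>)}"]
      by (metis (mono_tags, lifting) CollectI add.left_neutral insertI1)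
    ultimately show ?thesis by blast
  qed
  define \<psi> where "\<psi> x = (THE r. (x, r) \<in> G)" for x
  have \<psi>_G: "(x, \<psi> x) \<in> G" for x
    unfolding \<psi>_def using total[of x] unique by (metis theI)
  have \<psi>_eq: "\<psi> x = r" if "(x, r) \<in> G" for x r
    using unique[OF \<psi>_G that] .
  show ?thesis
  proof (rule that)
    show "linear \<psi>"
      by (rule linearI) (auto intro!: \<psi>_eq G_add G_scale \<psi>_G)
    show "\<psi> x = \<phi> x" if "x \<in> W" for x
      using that \<open>G0 \<subseteq> G\<close> by (intro \<psi>_eq) (auto simp: G0_def)
    show "\<psi> x \<le> p x" for x
      using G_le \<psi>_G by blast
  qed
qed

theorem (in normed_space_over) norm_preserving_extension:
  fixes \<phi> :: "'a \<Rightarrow> 'k"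
  assumes "subspace W" and "C \<ge> 0"
    and \<phi>_add: "\<And>x y. x \<in> W \<Longrightarrow> y \<in> W \<Longrightarrow> \<phi> (x + y) = \<phi> x + \<phi> y"
    and \<phi>_scale: "\<And>c x. x \<in> W \<Longrightarrow> \<phi> (scale c x) = c * \<phi> x"
    and \<phi>_le: "\<And>x. x \<in> W \<Longrightarrow> norm (\<phi> x) \<le> C * norm x"
  obtains \<Phi> where "\<And>x y. \<Phi> (x + y) = \<Phi> x + \<Phi> y" "\<And>c x. \<Phi> (scale c x) = c * \<Phi> x"
    "\<And>x. x \<in> W \<Longrightarrow> \<Phi> x = \<phi> x" "\<And>x. norm (\<Phi> x) \<le> C * norm x"
proof -
  have W_real: "Real_Vector_Spaces.subspace W"
  proof (rule Real_Vector_Spaces.subspaceI)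
    show "r *\<^sub>R x \<in> W" if "x \<in> W" for r x
      using subspace_scale[OF assms(1) that, of "of_real r"] by (simp add: scale_of_real)
  qed (use assms(1) in \<open>simp_all add: subspace_0 subspace_add\<close>)
  obtain \<psi> where \<psi>: "linear \<psi>" "\<And>x. x \<in> W \<Longrightarrow> \<psi> x = real_part (\<phi> x)"
      "\<And>x. \<psi> x \<le> C * norm x"
  proof (rule linear_extension_dominated[of "\<lambda>x. C * norm x" W "\<lambda>x. real_part (\<phi> x)"])
    show "C * norm (x + y) \<le> C * norm x + C * norm y" for x y :: 'a
      using \<open>C \<ge> 0\<close> by (metis distrib_left mult_left_mono norm_triangle_ineq)
    show "real_part (\<phi> (r *\<^sub>R x)) = r * real_part (\<phi> x)" if "x \<in> W" for r x
      using \<phi>_scale[OF that, of "of_real r"] by (simp add: scale_of_real flip: scaleR_conv_of_real)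
    show "real_part (\<phi> x) \<le> C * norm x" if "x \<in> W" for x
      using \<phi>_le[OF that] real_part_le_norm[of "\<phi> x"] by linarith
  qed (simp_all add: W_real \<phi>_add)
  have \<psi>_scale: "\<psi> (r *\<^sub>R x) = r * \<psi> x" for r x
    using Real_Vector_Spaces.linear_scale[OF \<psi>(1)] by simp
  obtain \<Phi> where \<Phi>: "\<And>x y. \<Phi> (x + y) = \<Phi> x + \<Phi> y" "\<And>c x. \<Phi> (scale c x) = c * \<Phi> x"
      "\<And>x. real_part (\<Phi> x) = \<psi> x"
    using scalar_functional_with_real_part[OF Real_Vector_Spaces.linear_add[OF \<psi>(1)] \<psi>_scale]
    by blast
  show ?thesis
  proof (rule that)
    show "norm (\<Phi> x) \<le> C * norm x" for x
      using \<Phi>(2,3) \<psi>(3) by (intro norm_le_if_real_part_le) auto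
    (* The two functionals are known to have the same real part on W; if they differed at x, then
       scaling x so that the difference becomes 1 would contradict this. *)
    show "\<Phi> x = \<phi> x" if "x \<in> W" for x
    proof (rule ccontr)
      assume "\<Phi> x \<noteq> \<phi> x"
      define c where "c = 1 / (\<Phi> x - \<phi> x)"
      have "c * \<Phi> x = 1 + c * \<phi> x"
        using \<open>\<Phi> x \<noteq> \<phi> x\<close> by (simp add: c_def field_simps)
      then have "real_part (\<Phi> (scale c x)) = 1 + real_part (\<phi> (scale c x))"
        using real_part_simps(2)[of 1, where 'k = 'k] by (simp add: \<Phi>(2) \<phi>_scale[OF that])
      moreover have "scale c x \<in> W"
        using assms(1) that by (rule subspace_scale)
      ultimately show False
        using \<Phi>(3) \<psi>(2) by simp
    qed
  qed (use \<Phi> in auto)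
qed

lemma (in normed_space_over) norming_functional:
  assumes "v \<noteq> 0"
  obtains \<Phi> where "\<And>x y. \<Phi> (x + y) = \<Phi> x + \<Phi> y" "\<And>c x. \<Phi> (scale c x) = c * \<Phi> x"
    "\<Phi> v = of_real (norm v)" "\<And>x. norm (\<Phi> x) \<le> norm x"
proof -
  (* The functional that sends the multiple c of v to c times the norm of v; c is unique because v
     is nonzero. *)
  define \<phi> where "\<phi> x = (THE c. x = scale c v) * of_real (norm v)" for x
  have \<phi>: "\<phi> (scale c v) = c * of_real (norm v)" for c
    using assms by (simp add: \<phi>_def)
  have W: "x \<in> span {v} \<longleftrightarrow> (\<exists>c. x = scale c v)" for x
    by (auto simp: span_singleton)
  have "subspace (span {v})" and "(0::real) \<le> 1"
    by simp_all
  moreover have "\<phi> (x + y) = \<phi> x + \<phi> y" if "x \<in> span {v}" "y \<in> span {v}" for x y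
  proof -
    obtain c d where "x = scale c v" "y = scale d v" using \<open>x \<in> span {v}\<close> \<open>y \<in> span {v}\<close> W by blast
    then show ?thesis
      by (metis \<phi> distrib_right scale_left_distrib)
  qed
  moreover have "\<phi> (scale c x) = c * \<phi> x" if "x \<in> span {v}" for c x
    using \<phi>[of "c * _"] that unfolding W by (auto simp: \<phi>)
  moreover have "norm (\<phi> x) \<le> 1 * norm x" if "x \<in> span {v}" for x
    using that unfolding W by (auto simp: \<phi> norm_mult norm_scale)
  ultimately obtain \<Phi> where \<Phi>: "\<And>x y. \<Phi> (x + y) = \<Phi> x + \<Phi> y" "\<And>c x. \<Phi> (scale c x) = c * \<Phi> x"
    "\<And>x. x \<in> span {v} \<Longrightarrow> \<Phi> x = \<phi> x" "\<And>x. norm (\<Phi> x) \<le> 1 * norm x"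
    using norm_preserving_extension[of "span {v}" 1 \<phi>] by blast
  moreover have "\<Phi> v = of_real (norm v)"
    using \<Phi>(3)[OF span_base] \<phi>[of 1] by simp
  ultimately show ?thesis
    by (intro that[of \<Phi>]) auto
qed

text \<open>The real numbers are an instance of the scalar class, so this is a special case.\<close>

lemma norming_blinfun:
  fixes v :: "'a::real_normed_vector"
  obtains \<psi> :: "'a \<Rightarrow>\<^sub>L real" where "\<psi> v = norm v" "norm \<psi> \<le> 1"
proof (cases "v = 0")
  case True
  then show ?thesis by (intro that[of 0]) simp_all
next
  case False
  interpret normed_space_over "(*\<^sub>R) :: real \<Rightarrow> 'a \<Rightarrow> 'a"
    by unfold_locales (simp_all add: algebra_simps)
  obtain \<Phi> where \<Phi>: "\<And>x y. \<Phi> (x + y) = \<Phi> x + \<Phi> y" "\<And>c x. \<Phi> (c *\<^sub>R x) = c * \<Phi> x"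
    "\<Phi> v = of_real (norm v)" "\<And>x. norm (\<Phi> x) \<le> norm x"
    using norming_functional[OF False] by metis
  have "bounded_linear \<Phi>"
    by (rule bounded_linear_intro[of _ 1]) (use \<Phi> in auto)
  then show ?thesis
    using \<Phi>(3,4) by (intro that[of "Blinfun \<Phi>"] norm_blinfun_bound)
      (simp_all add: bounded_linear_Blinfun_apply)
qed

section \<open>The uniform boundedness principle\<close>

text \<open>
  The functionals bounded by \<open>N\<close> on \<open>T\<close> form closed sets that cover the dual space, so by Baire
  one of them contains a ball. By translation, all functionals of some fixed positive norm are then
  bounded by \<open>2 N\<close> on \<open>T\<close>, in particular a multiple of one that attains the norm of a given
  \<open>v \<in> T\<close>.
\<close>

theorem bounded_if_weakly_bounded:
  fixes T :: "'a::real_normed_vector set"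
  assumes "\<And>\<psi> :: 'a \<Rightarrow>\<^sub>L real. \<exists>C. \<forall>v\<in>T. \<bar>\<psi> v\<bar> \<le> C"
  shows "bounded T"
proof -
  define S where "S N = {\<psi> :: 'a \<Rightarrow>\<^sub>L real. \<forall>v\<in>T. \<bar>\<psi> v\<bar> \<le> real N}" for N
  have S_closed: "closed (S N)" for N
  proof -
    have "S N = (\<Inter>v\<in>T. {\<psi>. \<bar>blinfun_apply \<psi> v\<bar> \<le> real N})"
      by (auto simp: S_def)
    then show ?thesis
      by (auto intro!: closed_INT closed_Collect_le continuous_intros)
  qed
  have "\<Union>(range S) = UNIV"
  proof -
    have "\<exists>N. \<psi> \<in> S N" for \<psi>
    proof -
      obtain C where "\<forall>v\<in>T. \<bar>blinfun_apply \<psi> v\<bar> \<le> C" using assms by blast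
      moreover obtain N where "C \<le> real N" using real_arch_simple by blast
      ultimately have "\<psi> \<in> S N"
        unfolding S_def by (auto intro: order_trans)
      then show ?thesis ..
    qed
    then show ?thesis by blast
  qed
  then have "euclidean interior_of \<Union>(range S) \<noteq> {}"
    by simp
  then obtain N where "interior (S N) \<noteq> {}"
    using Baire_category_alt[of euclidean "range S"] S_closed completely_metrizable_space_euclidean
    by fastforce
  then obtain \<psi>0 e where "e > 0" and ball: "cball \<psi>0 e \<subseteq> S N"
    by (meson all_not_in_conv mem_interior_cball)
  have "norm v \<le> 2 * real N / e" if "v \<in> T" for v
  proof -
    obtain \<psi> :: "'a \<Rightarrow>\<^sub>L real" where \<psi>: "\<psi> v = norm v" "norm \<psi> \<le> 1" by (rule norming_blinfun)
    have "\<psi>0 + e *\<^sub>R \<psi> \<in> cball \<psi>0 e" "\<psi>0 \<in> cball \<psi>0 e"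
      using \<open>e > 0\<close> \<psi>(2) by (simp_all add: dist_norm)
    then have "\<bar>(\<psi>0 + e *\<^sub>R \<psi>) v\<bar> \<le> real N" "\<bar>\<psi>0 v\<bar> \<le> real N"
      using subsetD[OF ball] that unfolding S_def by blast+
    then have "e * norm v \<le> 2 * real N"
      using \<psi>(1) by (simp add: blinfun.bilinear_simps)
    then show ?thesis
      using \<open>e > 0\<close> by (simp add: field_simps)
  qed
  then show ?thesis
    by (auto simp: bounded_iff)
qed

section \<open>Injective linear maps between subspaces of equal finite dimension\<close>

text \<open>
  The image of a basis of \<open>X\<close> is independent and has as many elements as a basis of \<open>Y\<close>. A vector
  of \<open>Y\<close> outside its span could be added to give an independent set that is too large.
\<close>

lemma (in vector_space_pair) inj_on_imp_image_eq_if_dim_eq: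
  assumes f: "Vector_Spaces.linear s1 s2 f" and X: "vs1.subspace X"
    and D: "finite D" "vs2.span D = Y"
    and dim: "vs1.dim X = vs2.dim Y" and "f ` X \<subseteq> Y" and inj: "inj_on f X"
  shows "f ` X = Y"
proof -
  obtain A where A: "A \<subseteq> X" "vs1.independent A" "X \<subseteq> vs1.span A" "card A = vs1.dim X"
    by (rule vs1.basis_exists)
  have span_A: "vs1.span A = X"
    using A X by (simp add: subset_antisym vs1.span_minimal)
  obtain E where E: "E \<subseteq> Y" "vs2.independent E" "Y \<subseteq> vs2.span E" "card E = vs2.dim Y"
    by (rule vs2.basis_exists)
  have "finite E"
    using vs2.independent_span_bound[OF D(1) E(2)] D(2) E(1) by blast
  have fA: "vs2.independent (f ` A)"
    using linear_independent_injective_image[OF f A(2)] inj span_A by simp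
  have fA_E: "f ` A \<subseteq> vs2.span E"
    using A(1) E(3) \<open>f ` X \<subseteq> Y\<close> by blast
  have "finite (f ` A)"
    using vs2.independent_span_bound[OF \<open>finite E\<close> fA fA_E] by blast
  have "Y \<subseteq> vs2.span (f ` A)"
  proof (rule ccontr)
    assume "\<not> Y \<subseteq> vs2.span (f ` A)"
    then obtain y where y: "y \<in> Y" "y \<notin> vs2.span (f ` A)" by blast
    then have "card (insert y (f ` A)) \<le> card E"
      using vs2.independent_span_bound[OF \<open>finite E\<close> vs2.independent_insertI[OF y(2) fA]] fA_E E(3)
      by blast
    moreover have "y \<notin> f ` A"
      using y(2) vs2.span_base by blast
    moreover have "card (f ` A) = card E"
      using card_image[OF inj_on_subset[OF inj A(1)]] A(4) E(4) dim by simp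
    ultimately show False
      using \<open>finite (f ` A)\<close> by simp
  qed
  then show ?thesis
    using linear_span_image[OF f, of A] span_A \<open>f ` X \<subseteq> Y\<close> by auto
qed

section \<open>Bounded sesquilinear forms and the inf-sup inequality\<close>

locale bounded_sesquilinear_form =
  U: banach_space_over sU + V: banach_space_over sV
  for sU :: "'k::real_or_complex \<Rightarrow> 'u::banach \<Rightarrow> 'u" and sV :: "'k \<Rightarrow> 'v::banach \<Rightarrow> 'v" +
  fixes a :: "'u \<Rightarrow> 'v \<Rightarrow> 'k"
  assumes sesquilinear: "sesquilinear sU sV a"
    and continuous: "continuous_form a"
begin

lemma form_simps:
  "a (u + u') v = a u v + a u' v" "a (sU c u) v = c * a u v"
  "a u (v + v') = a u v + a u v'" "a u (sV c v) = scalar_cnj c * a u v"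
  using sesquilinear by (auto simp: sesquilinear_def)

lemma form_scaleR: "a (r *\<^sub>R u) v = r *\<^sub>R a u v" "a u (r *\<^sub>R v) = r *\<^sub>R a u v"
  using form_simps(2)[of "of_real r"] form_simps(4)[of _ "of_real r"]
  by (simp_all add: U.scale_of_real V.scale_of_real flip: scaleR_conv_of_real)

sublocale bilinear: bounded_bilinear a
proof
  show "\<exists>K. \<forall>u v. norm (a u v) \<le> norm u * norm v * K"
    using continuous by (auto simp: continuous_form_def mult_ac)
qed (auto simp: form_simps form_scaleR)

lemma adjoint: "bounded_sesquilinear_form sV sU (adjoint_form a)"
proof
  show "sesquilinear sV sU (adjoint_form a)"
    by (auto simp: sesquilinear_def adjoint_form_def form_simps scalar_cnj_add scalar_cnj_mult)
  show "continuous_form (adjoint_form a)"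
    using continuous by (auto simp: continuous_form_def adjoint_form_def mult_ac)
qed

end

lemma adjoint_adjoint_form [simp]: "adjoint_form (adjoint_form a) = a"
  by (simp add: adjoint_form_def fun_eq_iff)

lemma BNB_star_eq: "BNB_star a U V = BNB (adjoint_form a) V U"
  by (simp add: BNB_star_def BNB_def adjoint_form_def)

text \<open>
  If \<open>Y \<noteq> {0}\<close>, the norm of \<open>a u\<close> on \<open>Y\<close> is the least \<open>C\<close> with \<open>norm (a u v) \<le> C * norm v\<close> for \<open>v \<in> Y\<close>;
  quantifying over all such \<open>C\<close> expresses that this norm is at least \<open>\<beta> * norm u\<close> without
  mentioning a supremum.
\<close>

definition inf_sup_bound ::
    "real \<Rightarrow> ('u::real_normed_vector \<Rightarrow> 'v::real_normed_vector \<Rightarrow> 'k::real_normed_vector) \<Rightarrow>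
     'u set \<Rightarrow> 'v set \<Rightarrow> bool" where
  "inf_sup_bound \<beta> a X Y \<longleftrightarrow>
     (\<forall>u\<in>X. \<forall>C. (\<forall>v\<in>Y. norm (a u v) \<le> C * norm v) \<longrightarrow> \<beta> * norm u \<le> C)"

lemma inf_sup_boundD:
  "inf_sup_bound \<beta> a X Y \<Longrightarrow> u \<in> X \<Longrightarrow> (\<And>v. v \<in> Y \<Longrightarrow> norm (a u v) \<le> C * norm v) \<Longrightarrow> \<beta> * norm u \<le> C"
  by (auto simp: inf_sup_bound_def)

context bounded_sesquilinear_form
begin

lemma le_SUP_iff:
  assumes Y: "V.subspace Y" and "y \<in> Y" "y \<noteq> 0"
  shows "\<beta> \<le> (SUP v\<in>{v\<in>Y. norm v = 1}. norm (a u v)) \<longleftrightarrow>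
    (\<forall>C. (\<forall>v\<in>Y. norm (a u v) \<le> C * norm v) \<longrightarrow> \<beta> \<le> C)"
proof -
  define S where "S = {v\<in>Y. norm v = 1}"
  have unit: "(1 / norm v) *\<^sub>R v \<in> S" if "v \<in> Y" "v \<noteq> 0" for v
    using V.subspace_scale[OF Y that(1), of "of_real (1 / norm v)"] that(2)
    unfolding V.scale_of_real by (simp add: S_def)
  then have "S \<noteq> {}"
    using assms(2,3) by blast
  obtain M where M: "\<And>u v. norm (a u v) \<le> M * norm u * norm v"
    using continuous unfolding continuous_form_def by blast
  have bdd: "bdd_above ((\<lambda>v. norm (a u v)) ` S)"
  proof (rule bdd_aboveI2)
    show "norm (a u v) \<le> M * norm u" if "v \<in> S" for v
      using M[of u v] that by (simp add: S_def)
  qed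
  have "(\<forall>v\<in>Y. norm (a u v) \<le> C * norm v) \<longleftrightarrow> (SUP v\<in>S. norm (a u v)) \<le> C" for C
  proof -
    have "norm (a u v) \<le> C * norm v" if "\<forall>v\<in>S. norm (a u v) \<le> C" and "v \<in> Y" for v
    proof (cases "v = 0")
      case False
      then have "norm (a u ((1 / norm v) *\<^sub>R v)) \<le> C"
        using that unit by blast
      then show ?thesis
        using False by (simp add: form_scaleR divide_le_eq)
    qed (simp add: bilinear.zero_right)
    then have "(\<forall>v\<in>Y. norm (a u v) \<le> C * norm v) \<longleftrightarrow> (\<forall>v\<in>S. norm (a u v) \<le> C)"
      by (auto simp: S_def)
    then show ?thesis
      using cSUP_le_iff[OF \<open>S \<noteq> {}\<close> bdd] by simp
  qed
  then show ?thesis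
    unfolding S_def[symmetric] by (meson order_refl order_trans)
qed

lemma BNB_iff_inf_sup_bound:
  assumes "\<And>n. n \<ge> 1 \<Longrightarrow> V.subspace (V n)" and "\<And>n. n \<ge> 1 \<Longrightarrow> \<exists>v\<in>V n. v \<noteq> 0"
  shows "BNB a U V \<longleftrightarrow> (\<exists>\<beta>>0. \<forall>n\<ge>1. inf_sup_bound \<beta> a (U n) (V n))"
proof -
  have "\<beta> * norm u \<le> (SUP v\<in>{v\<in>V n. norm v = 1}. norm (a u v)) \<longleftrightarrow>
    (\<forall>C. (\<forall>v\<in>V n. norm (a u v) \<le> C * norm v) \<longrightarrow> \<beta> * norm u \<le> C)" if "n \<ge> 1" for n u \<beta>
    using assms[OF that] le_SUP_iff by blast
  then show ?thesis
    by (auto simp: BNB_def inf_sup_bound_def)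
qed

text \<open>
  Approximate \<open>u\<close> by \<open>w \<in> U n\<close> up to \<open>\<epsilon>\<close>. A bound \<open>C\<close> for \<open>a u\<close> gives the bound \<open>C + M \<epsilon>\<close>
  for \<open>a w\<close>, to which the discrete inequality applies, and \<open>norm u \<le> norm w + \<epsilon>\<close>. Since \<open>\<epsilon>\<close> is
  arbitrary, the constant \<open>\<beta>\<close> survives unchanged.
\<close>

lemma inf_sup_bound_UNIV:
  assumes bound: "\<And>n. n \<ge> 1 \<Longrightarrow> inf_sup_bound \<beta> a (U n) (Y n)" and "\<beta> > 0"
    and U: "approximating_sequence sU U"
  shows "inf_sup_bound \<beta> a UNIV UNIV"
  unfolding inf_sup_bound_def
proof (intro ballI allI impI)
  fix u C assume C: "\<forall>v\<in>UNIV. norm (a u v) \<le> C * norm v"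
  obtain M where "M > 0" and M: "\<And>u v. norm (a u v) \<le> M * norm u * norm v"
    using continuous unfolding continuous_form_def by blast
  show "\<beta> * norm u \<le> C"
  proof (rule field_le_epsilon)
    fix e :: real assume "e > 0"
    define \<epsilon> where "\<epsilon> = e / (M + \<beta>)"
    have "\<epsilon> > 0"
      using \<open>e > 0\<close> \<open>M > 0\<close> \<open>\<beta> > 0\<close> by (simp add: \<epsilon>_def)
    have "(\<lambda>n. infdist u (U n)) \<longlonglongrightarrow> 0"
      using U by (simp add: approximating_sequence_def)
    then have "\<forall>\<^sub>F n in sequentially. n \<ge> 1 \<and> infdist u (U n) < \<epsilon>"
      using \<open>\<epsilon> > 0\<close> by (intro eventually_conj eventually_ge_at_top order_tendstoD)
    then obtain n where n: "n \<ge> 1" "infdist u (U n) < \<epsilon>"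
      using eventually_happens'[OF sequentially_bot] by blast
    have "0 \<in> U n"
      using U n(1) by (intro U.subspace_0) (simp add: approximating_sequence_def finite_dim_subspace_def)
    then have "U n \<noteq> {}"
      by blast
    then obtain w where w: "w \<in> U n" "norm (u - w) < \<epsilon>"
      using n(2) cINF_less_iff[OF _ bdd_below_image_dist, of "U n" u \<epsilon>]
      by (auto simp: infdist_def dist_norm)
    have "norm (a w v) \<le> (C + M * \<epsilon>) * norm v" for v
    proof -
      have "a w v = a u v - a (u - w) v"
        by (simp add: bilinear.diff_left)
      then have "norm (a w v) \<le> norm (a u v) + norm (a (u - w) v)"
        by (metis norm_triangle_ineq4)
      also have "\<dots> \<le> C * norm v + M * \<epsilon> * norm v"
        using C M[of "u - w" v] w(2) \<open>M > 0\<close>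
        by (intro add_mono) (auto elim!: order_trans intro!: mult_right_mono)
      finally show ?thesis by (simp add: algebra_simps)
    qed
    then have "\<beta> * norm w \<le> C + M * \<epsilon>"
      by (rule inf_sup_boundD[OF bound[OF n(1)] w(1)])
    moreover have "norm u \<le> norm w + \<epsilon>"
      using norm_triangle_ineq2[of u w] w(2) by linarith
    then have "\<beta> * norm u \<le> \<beta> * norm w + \<beta> * \<epsilon>"
      using \<open>\<beta> > 0\<close> by (simp flip: distrib_left)
    moreover have "(M + \<beta>) * \<epsilon> = e"
      using \<open>M > 0\<close> \<open>\<beta> > 0\<close> by (simp add: \<epsilon>_def)
    ultimately show "\<beta> * norm u \<le> C + e"
      by (simp add: algebra_simps)
  qed
qed

lemma inf_sup_bound_unique:
  assumes "inf_sup_bound \<beta> a X Y" "\<beta> > 0" and X: "U.subspace X"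
    and "u \<in> X" "u' \<in> X" "\<And>v. v \<in> Y \<Longrightarrow> a u v = a u' v"
  shows "u = u'"
proof -
  have "u - u' \<in> X"
    using X assms(4,5) by (rule U.subspace_diff)
  then have "\<beta> * norm (u - u') \<le> 0"
    by (rule inf_sup_boundD[OF assms(1)]) (simp add: bilinear.diff_left assms(6))
  then show ?thesis
    using \<open>\<beta> > 0\<close> by (simp add: mult_le_0_iff)
qed

text \<open>
  Solving \<open>a u v = L v\<close> on \<open>Y\<close> means matching the values at a basis \<open>B\<close> of \<open>Y\<close>. These values are
  the coordinates of the vector \<open>T u \<in> Y\<close> below, so solvability is the surjectivity of the linear
  map \<open>T\<close> from \<open>X\<close> to \<open>Y\<close>, which follows from its injectivity by counting dimensions.
\<close>

lemma finite_dim_well_posed: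
  assumes bound: "inf_sup_bound \<beta> a X Y" "\<beta> > 0"
    and X: "finite_dim_subspace sU X" and Y: "finite_dim_subspace sV Y"
    and dim: "U.dim X = V.dim Y"
  shows "well_posed sV a X Y"
  unfolding well_posed_def
proof
  fix L assume "L \<in> antidual_space sV"
  then have L_add: "L (v + v') = L v + L v'" and L_scale: "L (sV c v) = scalar_cnj c * L v" for c v v'
    by (auto simp: antidual_space_def linear_simps)
  have subX: "U.subspace X" and subY: "V.subspace Y"
    using X Y by (auto simp: finite_dim_subspace_def)
  obtain D where D: "finite D" "V.span D = Y"
    using Y by (auto simp: finite_dim_subspace_def)
  obtain B where B: "B \<subseteq> Y" "V.independent B" "Y \<subseteq> V.span B"
    by (rule V.basis_exists)
  have "finite B"
    using V.independent_span_bound[OF D(1) B(2)] B(1) D(2) by blast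
  have span_B: "V.span B = Y"
    using B subY by (simp add: subset_antisym V.span_minimal)
  have ext: "a u v = K v" if "\<And>b. b \<in> B \<Longrightarrow> a u b = K b" "v \<in> Y"
    and "\<And>v v'. K (v + v') = K v + K v'" "\<And>c v. K (sV c v) = scalar_cnj c * K v" for u v K
  proof -
    have "K 0 = 0" using that(3)[of 0 0] by simp
    then have "V.subspace {v. a u v = K v}"
      by (auto intro!: V.subspaceI simp: form_simps that bilinear.zero_right)
    then have "V.span B \<subseteq> {v. a u v = K v}"
      using that(1) by (intro V.span_minimal) auto
    then show ?thesis
      using that(2) span_B by blast
  qed
  interpret UV: vector_space_pair sU sV ..
  define T where "T u = (\<Sum>b\<in>B. sV (a u b) b)" for u
  have coeffs: "\<forall>b\<in>B. K b = K' b"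
    if "(\<Sum>b\<in>B. sV (K b) b) = (\<Sum>b\<in>B. sV (K' b) b)" for K K'
  proof -
    have "(\<Sum>b\<in>B. sV (K b - K' b) b) = 0"
      using that by (simp add: V.scale_left_diff_distrib sum_subtractf)
    then show ?thesis
      using V.independentD[OF B(2) \<open>finite B\<close> subset_refl, of "\<lambda>b. K b - K' b"] by auto
  qed
  have "T ` X = Y"
  proof (rule UV.inj_on_imp_image_eq_if_dim_eq[OF _ subX D dim])
    show "Vector_Spaces.linear sU sV T"
      by unfold_locales
        (simp_all add: T_def form_simps V.scale_left_distrib sum.distrib V.scale_sum_right)
    show "T ` X \<subseteq> Y"
      using B(1) subY by (auto simp: T_def intro!: V.subspace_sum V.subspace_scale)
    show "inj_on T X"
    proof (rule inj_onI)
      fix u u' assume u: "u \<in> X" "u' \<in> X" "T u = T u'"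
      then have "\<forall>b\<in>B. a u b = a u' b"
        using coeffs by (simp add: T_def)
      then have "a u v = a u' v" if "v \<in> Y" for v
        using ext[of u "a u'"] that by (simp add: form_simps)
      then show "u = u'"
        by (rule inf_sup_bound_unique[OF bound subX u(1,2)])
    qed
  qed
  moreover have "(\<Sum>b\<in>B. sV (L b) b) \<in> Y"
    using B(1) subY by (auto intro!: V.subspace_sum V.subspace_scale)
  ultimately obtain u where u: "u \<in> X" "T u = (\<Sum>b\<in>B. sV (L b) b)"
    by (metis imageE)
  have B_eq: "a u b = L b" if "b \<in> B" for b
    using coeffs[of "a u" L] u(2) that unfolding T_def by blast
  have "a u v = L v" if "v \<in> Y" for v
    by (rule ext[where K = L, OF B_eq that]) (simp_all add: L_add L_scale)
  then have "is_solution a X Y L u"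
    using u(1) by (simp add: is_solution_def)
  moreover have "u' = u" if "is_solution a X Y L u'" for u'
    using that calculation inf_sup_bound_unique[OF bound subX, of u' u] by (auto simp: is_solution_def)
  ultimately show "\<exists>!u. is_solution a X Y L u" by blast
qed

lemma antidual_space_cnjI:
  assumes "\<And>x y. \<phi> (x + y) = \<phi> x + \<phi> y" "\<And>c x. \<phi> (sV c x) = c * \<phi> x"
    and "\<And>x. norm (\<phi> x) \<le> K * norm x"
  shows "(\<lambda>x. scalar_cnj (\<phi> x)) \<in> antidual_space sV"
proof -
  have "bounded_linear (\<lambda>x. scalar_cnj (\<phi> x))"
  proof (rule bounded_linear_intro)
    show "scalar_cnj (\<phi> (r *\<^sub>R x)) = r *\<^sub>R scalar_cnj (\<phi> x)" for r x
      using assms(2)[of "of_real r" x]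
      by (simp add: V.scale_of_real scalar_cnj_mult flip: scaleR_conv_of_real)
         (simp add: scaleR_conv_of_real scalar_cnj_mult)
    show "norm (scalar_cnj (\<phi> x)) \<le> norm x * K" for x
      using assms(3)[of x] by (simp add: mult.commute)
  qed (simp add: assms(1) scalar_cnj_add)
  then show ?thesis
    by (simp add: antidual_space_def assms(2) scalar_cnj_mult)
qed

text \<open>
  The element of \<open>X\<close> that realises the adjoint inequality at \<open>v\<close> is the solution \<open>u\<close> whose datum
  is a functional of norm one with value \<open>norm v\<close> at \<open>v\<close>: then \<open>a u v = norm v\<close>, and the
  inequality for \<open>a\<close> bounds \<open>norm u\<close> by \<open>1 / \<beta>\<close>. A nonzero element of \<open>X\<close> forces
  \<open>C \<ge> 0\<close>, which settles the case \<open>v = 0\<close>.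
\<close>

lemma inf_sup_bound_adjoint:
  assumes bound: "inf_sup_bound \<beta> a X Y" "\<beta> > 0" and wp: "well_posed sV a X Y"
    and nontrivial: "u0 \<in> X" "u0 \<noteq> 0"
  shows "inf_sup_bound \<beta> (adjoint_form a) Y X"
  unfolding inf_sup_bound_def
proof (intro ballI allI impI)
  fix v C assume "v \<in> Y" and "\<forall>u\<in>X. norm (adjoint_form a v u) \<le> C * norm u"
  then have C: "norm (a u v) \<le> C * norm u" if "u \<in> X" for u
    using that by (simp add: adjoint_form_def)
  have "0 \<le> C * norm u0"
    using C[OF nontrivial(1)] norm_ge_zero order_trans by blast
  then have "C \<ge> 0"
    using nontrivial(2) by (simp add: zero_le_mult_iff)
  show "\<beta> * norm v \<le> C"
  proof (cases "v = 0")
    case True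
    then show ?thesis using \<open>C \<ge> 0\<close> by simp
  next
    case False
    obtain \<phi> where \<phi>: "\<And>x y. \<phi> (x + y) = \<phi> x + \<phi> y" "\<And>c x. \<phi> (sV c x) = c * \<phi> x"
      "\<phi> v = of_real (norm v)" "\<And>x. norm (\<phi> x) \<le> norm x"
      using V.norming_functional[OF False] by metis
    have "(\<lambda>x. scalar_cnj (\<phi> x)) \<in> antidual_space sV"
      by (rule antidual_space_cnjI[of \<phi> 1]) (use \<phi> in auto)
    then obtain u where u: "u \<in> X" "\<And>w. w \<in> Y \<Longrightarrow> a u w = scalar_cnj (\<phi> w)"
      using wp by (auto simp: well_posed_def is_solution_def)
    have "\<beta> * norm u \<le> 1"
      using bound(1) u(1) by (rule inf_sup_boundD) (simp add: u(2) \<phi>(4))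
    have "norm v \<le> C * norm u"
      using C[OF u(1)] u(2)[OF \<open>v \<in> Y\<close>] by (simp add: \<phi>(3))
    then have "\<beta> * norm v \<le> C * (\<beta> * norm u)"
      using \<open>\<beta> > 0\<close> by (simp add: mult.left_commute)
    also have "\<dots> \<le> C * 1"
      using \<open>C \<ge> 0\<close> \<open>\<beta> * norm u \<le> 1\<close> by (intro mult_left_mono)
    finally show ?thesis by simp
  qed
qed

end

section \<open>Existence of solutions by reflexivity\<close>

definition blinfun_scale :: "'k::real_normed_field \<Rightarrow> ('a::real_normed_vector \<Rightarrow>\<^sub>L 'k) \<Rightarrow> 'a \<Rightarrow>\<^sub>L 'k" where
  "blinfun_scale c f = blinfun_mult_right c o\<^sub>L f"

lemma blinfun_scale_apply [simp]: "blinfun_scale c f x = c * f x"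
  by (simp add: blinfun_scale_def)

lemma normed_space_over_blinfun:
  "normed_space_over (blinfun_scale :: 'k::real_or_complex \<Rightarrow> ('a::real_normed_vector \<Rightarrow>\<^sub>L 'k) \<Rightarrow> _)"
proof
  fix c d :: 'k and f g :: "'a \<Rightarrow>\<^sub>L 'k" and r :: real
  show "blinfun_scale c (f + g) = blinfun_scale c f + blinfun_scale c g"
    "blinfun_scale (c + d) f = blinfun_scale c f + blinfun_scale d f"
    "blinfun_scale c (blinfun_scale d f) = blinfun_scale (c * d) f"
    "blinfun_scale 1 f = f" "blinfun_scale (of_real r) f = r *\<^sub>R f"
    by (simp_all add: blinfun_eqI blinfun.bilinear_simps algebra_simps scaleR_conv_of_real)
  have le: "norm (blinfun_scale c f) \<le> norm c * norm f" for c :: 'k and f :: "'a \<Rightarrow>\<^sub>L 'k"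
    by (rule norm_blinfun_bound)
      (simp_all add: norm_mult mult.assoc mult_left_mono norm_blinfun)
  show "norm (blinfun_scale c f) = norm c * norm f"
  proof (cases "c = 0")
    case True
    then show ?thesis using le[of c f] by simp
  next
    case False
    have "blinfun_scale (inverse c) (blinfun_scale c f) = f"
      using False by (simp add: blinfun_eqI flip: mult.assoc)
    then have "norm f \<le> inverse (norm c) * norm (blinfun_scale c f)"
      using le[of "inverse c" "blinfun_scale c f"] by (simp add: norm_inverse)
    then have "norm c * norm f \<le> norm (blinfun_scale c f)"
      using False by (simp add: field_simps)
    then show ?thesis using le[of c f] by linarith
  qed
qed

context bounded_sesquilinear_form
begin

text \<open>
  A solution is a point \<open>u\<close> whose evaluation functional takes the value \<open>L v\<close> at each
  \<open>F v = a(-, v)\<close>. The adjoint inequality says that \<open>F\<close> is bounded below, so these values define a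
  functional on the range of \<open>F\<close> that is bounded for the dual norm; it is linear because \<open>F\<close> and
  \<open>L\<close> are both antilinear. Its extension to the dual space is an evaluation by reflexivity.
\<close>

lemma solution_exists_if_reflexive:
  assumes bound: "inf_sup_bound \<beta> (adjoint_form a) UNIV UNIV" "\<beta> > 0"
    and refl: "reflexive_space sU" and L: "L \<in> antidual_space sV"
  obtains u where "\<And>v. a u v = L v"
proof -
  interpret D: normed_space_over "blinfun_scale :: 'k \<Rightarrow> ('u \<Rightarrow>\<^sub>L 'k) \<Rightarrow> _"
    by (rule normed_space_over_blinfun)
  have L_add: "L (v + v') = L v + L v'" and L_scale: "L (sV c v) = scalar_cnj c * L v" for c v v'
    using L by (auto simp: antidual_space_def linear_simps)
  have "bounded_linear L"
    using L by (simp add: antidual_space_def)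
  then obtain K where "K > 0" and K: "\<And>v. norm (L v) \<le> norm v * K"
    using bounded_linear.pos_bounded by blast
  define F where "F v = Blinfun (\<lambda>u. a u v)" for v
  have F_apply [simp]: "F v u = a u v" for u v
    by (simp add: F_def bounded_linear_Blinfun_apply bilinear.bounded_linear_left)
  have F_add: "F v + F w = F (v + w)" and F_scale: "blinfun_scale c (F v) = F (sV (scalar_cnj c) v)"
    for v w c
    by (simp_all add: blinfun_eqI blinfun.add_left form_simps)
  have F_ge: "\<beta> * norm v \<le> norm (F v)" for v
  proof (rule inf_sup_boundD[OF bound(1)])
    show "norm (adjoint_form a v u) \<le> norm (F v) * norm u" for u
      using norm_blinfun[of "F v" u] by (simp add: adjoint_form_def)
  qed simp
  have "inj F"
  proof (rule injI)
    fix v w assume "F v = F w"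
    then have "F (v - w) = 0"
      using F_add[of "v - w" w] by simp
    then have "\<beta> * norm (v - w) \<le> 0"
      using F_ge[of "v - w"] by simp
    then show "v = w"
      using \<open>\<beta> > 0\<close> by (simp add: mult_le_0_iff)
  qed
  define \<phi> where "\<phi> f = L (inv F f)" for f
  have \<phi>_F [simp]: "\<phi> (F v) = L v" for v
    using \<open>inj F\<close> by (simp add: \<phi>_def)
  have "0 \<le> K / \<beta>"
    using \<open>K > 0\<close> \<open>\<beta> > 0\<close> by simp
  obtain \<Phi> where \<Phi>: "\<And>f g. \<Phi> (f + g) = \<Phi> f + \<Phi> g"
    "\<And>c f. \<Phi> (blinfun_scale c f) = c * \<Phi> f" "\<And>f. f \<in> range F \<Longrightarrow> \<Phi> f = \<phi> f"
    "\<And>f. norm (\<Phi> f) \<le> K / \<beta> * norm f"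
  proof (rule D.norm_preserving_extension[of "range F" "K / \<beta>" \<phi>])
    show "D.subspace (range F)"
    proof (rule D.subspaceI)
      show "0 \<in> range F"
        by (rule range_eqI[of _ _ 0]) (simp add: blinfun_eqI bilinear.zero_right)
    qed (auto simp: F_add F_scale)
    show "\<phi> (f + g) = \<phi> f + \<phi> g" if "f \<in> range F" "g \<in> range F" for f g
      using that by (auto simp: F_add L_add)
    show "\<phi> (blinfun_scale c f) = c * \<phi> f" if "f \<in> range F" for c f
      using that by (auto simp: F_scale L_scale)
    show "norm (\<phi> f) \<le> K / \<beta> * norm f" if f: "f \<in> range F" for f
    proof -
      obtain v where v: "f = F v" using f by blast
      have "norm (L v) \<le> K / \<beta> * (\<beta> * norm v)"
        using K[of v] \<open>\<beta> > 0\<close> by (simp add: mult.commute)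
      also have "\<dots> \<le> K / \<beta> * norm f"
        using F_ge[of v] \<open>0 \<le> K / \<beta>\<close> unfolding v by (intro mult_left_mono)
      finally show ?thesis by (simp add: v)
    qed
  qed (use \<open>0 \<le> K / \<beta>\<close> in blast)+
  have "bidual_element sU (\<lambda>f. \<Phi> (Blinfun f))"
    unfolding bidual_element_def
  proof (intro conjI ballI allI exI)
    fix f g assume "f \<in> dual_space sU" "g \<in> dual_space sU"
    then have fg: "bounded_linear f" "bounded_linear g" by (auto simp: dual_space_def)
    then have "Blinfun (\<lambda>x. f x + g x) = Blinfun f + Blinfun g"
      by (intro blinfun_eqI) (simp add: bounded_linear_Blinfun_apply blinfun.add_left bounded_linear_add)
    then show "\<Phi> (Blinfun (\<lambda>x. f x + g x)) = \<Phi> (Blinfun f) + \<Phi> (Blinfun g)"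
      by (simp add: \<Phi>(1))
  next
    fix c f assume "f \<in> dual_space sU"
    then have f: "bounded_linear f" by (auto simp: dual_space_def)
    then have "Blinfun (\<lambda>x. c * f x) = blinfun_scale c (Blinfun f)"
      by (intro blinfun_eqI) (simp add: bounded_linear_Blinfun_apply bounded_linear_const_mult)
    then show "\<Phi> (Blinfun (\<lambda>x. c * f x)) = c * \<Phi> (Blinfun f)"
      by (simp add: \<Phi>(2))
  next
    fix f assume "f \<in> dual_space sU"
    then show "norm (\<Phi> (Blinfun f)) \<le> K / \<beta> * onorm f"
      using \<Phi>(4)[of "Blinfun f"]
      by (simp add: dual_space_def norm_blinfun.rep_eq bounded_linear_Blinfun_apply)
  qed
  then obtain u where u: "\<And>f. f \<in> dual_space sU \<Longrightarrow> \<Phi> (Blinfun f) = f u"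
    using refl unfolding reflexive_space_def by blast
  have "a u v = L v" for v
  proof -
    have "(\<lambda>u. a u v) \<in> dual_space sU"
      by (simp add: dual_space_def bilinear.bounded_linear_left form_simps)
    then have "\<Phi> (F v) = a u v"
      using u by (simp add: F_def)
    then show ?thesis
      using \<Phi>(3)[of "F v"] by simp
  qed
  then show ?thesis by (rule that)
qed

section \<open>Error estimate\<close>

text \<open>
  For \<open>x \<in> X\<close>, Galerkin orthogonality makes \<open>a (u' - x)\<close> and \<open>a (u - x)\<close> agree on \<open>Y\<close>, so the
  inf-sup inequality bounds the distance of \<open>u'\<close> from \<open>x\<close> by \<open>M / \<beta>\<close> times that of \<open>u\<close> from
  \<open>x\<close>. The triangle inequality and the infimum over \<open>x\<close> finish the estimate.
\<close>

lemma quasi_optimality: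
  assumes bound: "inf_sup_bound \<beta> a X Y" "\<beta> > 0" and X: "U.subspace X"
    and M: "M > 0" "\<And>u v. norm (a u v) \<le> M * norm u * norm v"
    and u: "is_solution a UNIV UNIV L u" and u': "is_solution a X Y L u'"
  shows "norm (u - u') \<le> (1 + M / \<beta>) * infdist u X"
proof -
  have orth: "a u' v = a u v" if "v \<in> Y" for v
    using u u' that by (auto simp: is_solution_def)
  have "u' \<in> X" using u' by (simp add: is_solution_def)
  have "norm (u - u') / (1 + M / \<beta>) \<le> dist u x" if "x \<in> X" for x
  proof -
    have "u' - x \<in> X"
      using X \<open>u' \<in> X\<close> that by (rule U.subspace_diff)
    then have "\<beta> * norm (u' - x) \<le> M * norm (u - x)"
    proof (rule inf_sup_boundD[OF bound(1)])
      fix v assume "v \<in> Y"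
      then have "a (u' - x) v = a (u - x) v"
        by (simp add: bilinear.diff_left orth)
      then show "norm (a (u' - x) v) \<le> M * norm (u - x) * norm v"
        by (simp add: M(2))
    qed
    then have "norm (u' - x) \<le> M / \<beta> * norm (u - x)"
      using \<open>\<beta> > 0\<close> by (simp add: field_simps)
    moreover have "norm (u - u') \<le> norm (u - x) + norm (u' - x)"
      using norm_triangle_ineq4[of "u - x" "u' - x"] by simp
    ultimately have "norm (u - u') \<le> (1 + M / \<beta>) * norm (u - x)"
      by (simp add: algebra_simps)
    moreover have "1 + M / \<beta> > 0"
      using M(1) \<open>\<beta> > 0\<close> by (simp add: add_pos_pos)
    ultimately show ?thesis
      by (simp add: dist_norm pos_divide_le_eq mult.commute)
  qed
  moreover have "X \<noteq> {}"
    using \<open>u' \<in> X\<close> by blast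
  ultimately have "norm (u - u') / (1 + M / \<beta>) \<le> infdist u X"
    by (simp add: infdist_def cINF_greatest)
  moreover have "1 + M / \<beta> > 0"
    using M(1) \<open>\<beta> > 0\<close> by (simp add: add_pos_pos)
  ultimately show ?thesis
    by (simp add: pos_divide_le_eq mult.commute)
qed

end

section \<open>The three implications\<close>

text \<open>
  The assumptions are symmetric in the two spaces, so that the adjoint form satisfies them again
  with the roles exchanged.
\<close>

locale petrov_galerkin = bounded_sesquilinear_form sU sV a
  for sU :: "'k::real_or_complex \<Rightarrow> 'u::banach \<Rightarrow> 'u" and sV :: "'k \<Rightarrow> 'v::banach \<Rightarrow> 'v"
    and a :: "'u \<Rightarrow> 'v \<Rightarrow> 'k" +
  fixes Us :: "nat \<Rightarrow> 'u set" and Vs :: "nat \<Rightarrow> 'v set"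
  assumes reflexive_U: "reflexive_space sU" and reflexive_V: "reflexive_space sV"
    and approximating_U: "approximating_sequence sU Us"
    and approximating_V: "approximating_sequence sV Vs"
    and dims: "n \<ge> 1 \<Longrightarrow> U.dim (Us n) \<noteq> 0 \<and> U.dim (Us n) = V.dim (Vs n)"
begin

lemma dual: "petrov_galerkin sV sU (adjoint_form a) Vs Us"
proof (intro petrov_galerkin.intro adjoint petrov_galerkin_axioms.intro)
  show "V.dim (Vs n) \<noteq> 0 \<and> V.dim (Vs n) = U.dim (Us n)" if "n \<ge> 1" for n
    using dims[OF that] by simp
qed (fact reflexive_U reflexive_V approximating_U approximating_V)+

lemma finite_dim:
  "n \<ge> 1 \<Longrightarrow> finite_dim_subspace sU (Us n)" "n \<ge> 1 \<Longrightarrow> finite_dim_subspace sV (Vs n)"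
  using approximating_U approximating_V by (auto simp: approximating_sequence_def)

lemma subspaces: "n \<ge> 1 \<Longrightarrow> U.subspace (Us n)" "n \<ge> 1 \<Longrightarrow> V.subspace (Vs n)"
  using finite_dim by (auto simp: finite_dim_subspace_def)

lemma nontrivial: "n \<ge> 1 \<Longrightarrow> \<exists>u\<in>Us n. u \<noteq> 0"
proof (rule ccontr)
  assume "n \<ge> 1" "\<not> (\<exists>u\<in>Us n. u \<noteq> 0)"
  then have "Us n \<subseteq> U.span {}"
    by auto
  then have "U.dim (Us n) \<le> card ({} :: 'u set)"
    by (rule U.dim_le_card) simp
  then show False
    using dims[OF \<open>n \<ge> 1\<close>] by simp
qed

lemma BNB_iff: "BNB a Us Vs \<longleftrightarrow> (\<exists>\<beta>>0. \<forall>n\<ge>1. inf_sup_bound \<beta> a (Us n) (Vs n))"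
  by (rule BNB_iff_inf_sup_bound[OF subspaces(2) petrov_galerkin.nontrivial[OF dual]])

lemma BNB_adjoint:
  assumes "BNB a Us Vs"
  shows "BNB (adjoint_form a) Vs Us"
proof -
  obtain \<beta> where "\<beta> > 0" and bound: "\<And>n. n \<ge> 1 \<Longrightarrow> inf_sup_bound \<beta> a (Us n) (Vs n)"
    using assms BNB_iff by blast
  have "inf_sup_bound \<beta> (adjoint_form a) (Vs n) (Us n)" if "n \<ge> 1" for n
  proof -
    have "well_posed sV a (Us n) (Vs n)"
      using bound[OF that] \<open>\<beta> > 0\<close> finite_dim[OF that] dims[OF that]
      by (intro finite_dim_well_posed) auto
    then show ?thesis
      using bound[OF that] \<open>\<beta> > 0\<close> nontrivial[OF that] inf_sup_bound_adjoint by blast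
  qed
  then show ?thesis
    unfolding petrov_galerkin.BNB_iff[OF dual] using \<open>\<beta> > 0\<close> by blast
qed

lemma galerkin_converges_if_BNB:
  assumes "BNB a Us Vs"
  shows "galerkin_converges sV a Us Vs"
proof -
  interpret dual: petrov_galerkin sV sU "adjoint_form a" Vs Us
    by (rule dual)
  obtain \<beta> where \<beta>: "\<beta> > 0" "\<And>n. n \<ge> 1 \<Longrightarrow> inf_sup_bound \<beta> a (Us n) (Vs n)"
    using assms BNB_iff by blast
  obtain \<beta>' where \<beta>': "\<beta>' > 0" "\<And>n. n \<ge> 1 \<Longrightarrow> inf_sup_bound \<beta>' (adjoint_form a) (Vs n) (Us n)"
    using BNB_adjoint[OF assms] dual.BNB_iff by blast
  have bound: "inf_sup_bound \<beta> a UNIV UNIV"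
    by (rule inf_sup_bound_UNIV[OF \<beta>(2,1) approximating_U])
  have dual_bound: "inf_sup_bound \<beta>' (adjoint_form a) UNIV UNIV"
    by (rule dual.inf_sup_bound_UNIV[OF \<beta>'(2,1) approximating_V])
  have "well_posed sV a UNIV UNIV"
    unfolding well_posed_def
  proof
    fix L assume "L \<in> antidual_space sV"
    then obtain u where u: "\<And>v. a u v = L v"
      using solution_exists_if_reflexive[OF dual_bound \<beta>'(1) reflexive_U] by metis
    moreover have "u' = u" if "\<And>v. a u' v = L v" for u'
      by (rule inf_sup_bound_unique[OF bound \<beta>(1)]) (simp_all add: u that)
    ultimately show "\<exists>!u. is_solution a UNIV UNIV L u"
      unfolding is_solution_def by blast
  qed
  moreover have "well_posed sV a (Us n) (Vs n)" if "n \<ge> 1" for n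
    using \<beta>(2)[OF that] \<beta>(1) finite_dim[OF that] dims[OF that]
    by (intro finite_dim_well_posed) auto
  moreover obtain M where M: "M > 0" "\<And>u v. norm (a u v) \<le> M * norm u * norm v"
    using continuous unfolding continuous_form_def by blast
  moreover have "1 + M / \<beta> > 0"
    using M(1) \<beta>(1) by (simp add: add_pos_pos)
  ultimately show ?thesis
    unfolding galerkin_converges_def
    using quasi_optimality[OF \<beta>(2,1) subspaces(1) M] by blast
qed

text \<open>
  Convergence bounds the discrete solutions for each fixed datum uniformly in \<open>n\<close>, with no control
  over how the bound depends on the datum; the uniform boundedness principle supplies that control.
  It is applied to elements of the test spaces rather than to solution operators, which gives the
  inequality for the adjoint form directly and avoids extending functionals from the subspaces.
\<close>

lemma BNB_adjoint_if_galerkin_converges: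
  assumes "galerkin_converges sV a Us Vs"
  shows "BNB (adjoint_form a) Vs Us"
proof -
  interpret dual: petrov_galerkin sV sU "adjoint_form a" Vs Us
    by (rule dual)
  have wp: "well_posed sV a UNIV UNIV" and wp_n: "\<And>n. n \<ge> 1 \<Longrightarrow> well_posed sV a (Us n) (Vs n)"
    using assms by (auto simp: galerkin_converges_def)
  obtain \<gamma> where "\<gamma> > 0" and \<gamma>: "\<And>n L u u'. n \<ge> 1 \<Longrightarrow> L \<in> antidual_space sV \<Longrightarrow>
      is_solution a UNIV UNIV L u \<Longrightarrow> is_solution a (Us n) (Vs n) L u' \<Longrightarrow>
      norm (u - u') \<le> \<gamma> * infdist u (Us n)"
    using assms unfolding galerkin_converges_def by blast
  define T where "T = (\<Union>n\<in>{1..}. {v\<in>Vs n. \<forall>w\<in>Us n. norm (a w v) \<le> norm w})"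
  have "\<exists>C. \<forall>v\<in>T. \<bar>blinfun_apply \<psi> v\<bar> \<le> C" for \<psi> :: "'v \<Rightarrow>\<^sub>L real"
  proof -
    have "\<psi> (r *\<^sub>R x) = r * \<psi> x" for r x
      by (simp add: blinfun.scaleR_right)
    then obtain \<phi> where \<phi>: "\<And>x y. \<phi> (x + y) = \<phi> x + \<phi> y" "\<And>c x. \<phi> (sV c x) = c * \<phi> x"
      "\<And>x. real_part (\<phi> x) = \<psi> x"
      using V.scalar_functional_with_real_part[OF blinfun.add_right[of \<psi>]] by blast
    have \<phi>_le: "norm (\<phi> x) \<le> norm \<psi> * norm x" for x
    proof (rule V.norm_le_if_real_part_le)
      show "real_part (\<phi> x) \<le> norm \<psi> * norm x" for x
        using norm_blinfun[of \<psi> x] by (simp add: \<phi>(3))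
    qed (rule \<phi>(2))
    define L where "L x = scalar_cnj (\<phi> x)" for x
    have L: "L \<in> antidual_space sV"
      unfolding L_def by (rule antidual_space_cnjI[OF \<phi>(1,2) \<phi>_le])
    then obtain u where u: "is_solution a UNIV UNIV L u"
      using wp by (auto simp: well_posed_def)
    have "\<bar>\<psi> v\<bar> \<le> (1 + \<gamma>) * norm u" if v: "v \<in> T" for v
    proof -
      obtain n where n: "n \<ge> 1" "v \<in> Vs n" "\<And>w. w \<in> Us n \<Longrightarrow> norm (a w v) \<le> norm w"
        using v by (auto simp: T_def)
      obtain u' where u': "is_solution a (Us n) (Vs n) L u'"
        using wp_n[OF n(1)] L by (auto simp: well_posed_def)
      have "infdist u (Us n) \<le> norm u"
        using infdist_le[OF U.subspace_0[OF subspaces(1)[OF n(1)]], of u] by simp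
      then have "norm (u - u') \<le> \<gamma> * norm u"
        using \<gamma>[OF n(1) L u u'] \<open>\<gamma> > 0\<close> by (meson mult_left_mono less_imp_le order_trans)
      then have "norm u' \<le> (1 + \<gamma>) * norm u"
        using norm_triangle_ineq2[of u' u] by (simp add: norm_minus_commute algebra_simps)
      moreover have "\<bar>\<psi> v\<bar> \<le> norm (a u' v)"
        using u' n(2) real_part_le_norm[of "\<phi> v"] \<phi>(3)[of v] by (simp add: is_solution_def L_def)
      moreover have "norm (a u' v) \<le> norm u'"
        using u' n(3) by (simp add: is_solution_def)
      ultimately show ?thesis by linarith
    qed
    then show ?thesis by blast
  qed
  then have "bounded T"
    by (rule bounded_if_weakly_bounded)
  then obtain K where "K > 0" and K: "\<And>v. v \<in> T \<Longrightarrow> norm v \<le> K"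
    by (auto simp: bounded_pos)
  have "inf_sup_bound (1 / K) (adjoint_form a) (Vs n) (Us n)" if "n \<ge> 1" for n
    unfolding inf_sup_bound_def
  proof (intro ballI allI impI)
    fix v C assume v: "v \<in> Vs n" and "\<forall>u\<in>Us n. norm (adjoint_form a v u) \<le> C * norm u"
    then have C: "norm (a u v) \<le> C * norm u" if "u \<in> Us n" for u
      using that by (simp add: adjoint_form_def)
    obtain u0 where "u0 \<in> Us n" "u0 \<noteq> 0"
      using nontrivial[OF \<open>n \<ge> 1\<close>] by blast
    then have "0 \<le> C * norm u0"
      using C[OF \<open>u0 \<in> Us n\<close>] norm_ge_zero order_trans by blast
    then have "C \<ge> 0"
      using \<open>u0 \<noteq> 0\<close> by (simp add: zero_le_mult_iff)
    (* The form may vanish at v, in which case C = 0 is possible; hence v is normalised by C + e. *)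
    show "1 / K * norm v \<le> C"
    proof (rule field_le_epsilon)
      fix e :: real assume "e > 0"
      define c where "c = 1 / (C + e)"
      have "C + e > 0" "c > 0"
        using \<open>C \<ge> 0\<close> \<open>e > 0\<close> by (simp_all add: c_def)
      have "c *\<^sub>R v \<in> Vs n"
        using V.subspace_scale[OF subspaces(2)[OF \<open>n \<ge> 1\<close>] v, of "of_real c"]
        unfolding V.scale_of_real .
      moreover have "norm (a w (c *\<^sub>R v)) \<le> norm w" if "w \<in> Us n" for w
      proof -
        have "norm (a w v) \<le> (C + e) * norm w"
          using C[OF that] \<open>e > 0\<close> by (simp add: distrib_right add_increasing2)
        then show ?thesis
          using \<open>C + e > 0\<close> by (simp add: form_scaleR c_def divide_le_eq mult.commute)
      qed
      ultimately have "c *\<^sub>R v \<in> T"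
        using \<open>n \<ge> 1\<close> by (auto simp: T_def)
      then have "norm v / (C + e) \<le> K"
        using K[of "c *\<^sub>R v"] \<open>C + e > 0\<close> by (simp add: c_def)
      then show "1 / K * norm v \<le> C + e"
        using \<open>C + e > 0\<close> \<open>K > 0\<close> by (simp add: field_simps)
    qed
  qed
  moreover have "1 / K > 0"
    using \<open>K > 0\<close> by simp
  ultimately show ?thesis
    unfolding dual.BNB_iff by blast
qed

end

theorem theorem2p4:
  fixes sU :: "'k::real_or_complex \<Rightarrow> 'u::banach \<Rightarrow> 'u"
    and sV :: "'k \<Rightarrow> 'v::banach \<Rightarrow> 'v"
    and a :: "'u \<Rightarrow> 'v \<Rightarrow> 'k"
    and U :: "nat \<Rightarrow> 'u set"
    and V :: "nat \<Rightarrow> 'v set"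
  assumes "banach_space_over sU" and "banach_space_over sV"
    and "\<not> finite_dim_subspace sU UNIV" and "\<not> finite_dim_subspace sV UNIV"
    and "separable_space (euclidean :: 'u topology)" and "separable_space (euclidean :: 'v topology)"
    and "reflexive_space sU" and "reflexive_space sV"
    and "sesquilinear sU sV a" and "continuous_form a"
    and "approximating_sequence sU U" and "approximating_sequence sV V"
    and "\<forall>n\<ge>1. vector_space.dim sU (U n) \<noteq> 0 \<and>
                vector_space.dim sU (U n) = vector_space.dim sV (V n)"
  shows "(galerkin_converges sV a U V \<longleftrightarrow> BNB a U V) \<and>
         (BNB a U V \<longleftrightarrow> BNB_star a U V) \<and>
         (BNB_star a U V \<longleftrightarrow> galerkin_converges sU (adjoint_form a) V U)"
proof -
  interpret primal: petrov_galerkin sU sV a U V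
    by (intro petrov_galerkin.intro bounded_sesquilinear_form.intro
        bounded_sesquilinear_form_axioms.intro petrov_galerkin_axioms.intro) (use assms in auto)
  interpret dual: petrov_galerkin sV sU "adjoint_form a" V U
    by (rule primal.dual)
  have "BNB a U V \<longleftrightarrow> BNB (adjoint_form a) V U"
    using primal.BNB_adjoint dual.BNB_adjoint by auto
  moreover have "galerkin_converges sV a U V \<longleftrightarrow> BNB a U V"
    using primal.galerkin_converges_if_BNB primal.BNB_adjoint_if_galerkin_converges calculation by blast
  moreover have "BNB (adjoint_form a) V U \<longleftrightarrow> galerkin_converges sU (adjoint_form a) V U"
    using dual.galerkin_converges_if_BNB dual.BNB_adjoint_if_galerkin_converges calculation(1) by auto
  ultimately show ?thesis
    by (simp add: BNB_star_eq)
qed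

end
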